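(* Let $m\geq 3$ and $n$ be even positive integers. Then the stacked-book graph $G_{m,n}=S_m\Box P_n$ satisfies $$rn(G_{m,n})\leq \frac{mn^2}{2}+n-1.$$
   Context: $S_m$ denotes the star on $m$ vertices (one center vertex adjacent to $m-1$ leaves), $m\ge 3$, and $P_n$ the path on $n$ vertices. The stacked-book graph $G_{m,n}=S_m \Box P_n$ is their Cartesian product. For a simple connected graph $G$ with distance $d$ and diameter $\mathrm{diam}(G)$, a radio labeling is a function $f:V(G)\to \mathbb{Z}_{\ge 0}$ such that $|f(u)-f(v)|\geq \mathrm{diam}(G)+1-d(u,v)$ for all distinct $u,v\in V(G)$. The span of $f$ is $\max_{v} f(v)-\min_{v} f(v)$. The radio number $rn(G)$ is the minimum span over all radio labelings of $G$. *)

theory Defs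
  imports Complex_Main "Graph_Theory.Graph_Theory"
begin

text \<open>
  Simple graphs are modelled as in \<^theory>\<open>Graph_Theory.Pair_Digraph\<close>: an undirected edge is a
  pair of opposite arcs.
\<close>

definition star_graph :: "nat \<Rightarrow> nat pair_pre_digraph" where
  "star_graph m = \<lparr>pverts = {0..<m}, parcs = {0} \<times> {1..<m} \<union> {1..<m} \<times> {0}\<rparr>"

definition path_graph :: "nat \<Rightarrow> nat pair_pre_digraph" where
  "path_graph n =
     \<lparr>pverts = {0..<n}, parcs = {(i, j). i < n \<and> j < n \<and> (j = Suc i \<or> i = Suc j)}\<rparr>"

definition cartesian_product ::
    "'a pair_pre_digraph \<Rightarrow> 'b pair_pre_digraph \<Rightarrow> ('a \<times> 'b) pair_pre_digraph" where
  "cartesian_product G H =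
     \<lparr>pverts = pverts G \<times> pverts H,
      parcs = {((u, x), (v, y)) | u x v y.
                 (u = v \<and> u \<in> pverts G \<and> (x, y) \<in> parcs H) \<or>
                 ((u, v) \<in> parcs G \<and> x = y \<and> x \<in> pverts H)}\<rparr>"

definition stacked_book :: "nat \<Rightarrow> nat \<Rightarrow> (nat \<times> nat) pair_pre_digraph" where
  "stacked_book m n = cartesian_product (star_graph m) (path_graph n)"

text \<open>The following notions are meant for finite nonempty connected graphs only.\<close>

definition graph_dist :: "'a pair_pre_digraph \<Rightarrow> 'a \<Rightarrow> 'a \<Rightarrow> nat" where
  "graph_dist G u v = (LEAST k. \<exists>p. pre_digraph.awalk (with_proj G) u p v \<and> length p = k)"

definition graph_diam :: "'a pair_pre_digraph \<Rightarrow> nat" where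
  "graph_diam G = Max {graph_dist G u v | u v. u \<in> pverts G \<and> v \<in> pverts G}"

definition radio_labeling :: "'a pair_pre_digraph \<Rightarrow> ('a \<Rightarrow> nat) \<Rightarrow> bool" where
  "radio_labeling G f \<longleftrightarrow>
     (\<forall>u \<in> pverts G. \<forall>v \<in> pverts G. u \<noteq> v \<longrightarrow>
        \<bar>int (f u) - int (f v)\<bar> \<ge> int (graph_diam G) + 1 - int (graph_dist G u v))"

definition label_span :: "'a pair_pre_digraph \<Rightarrow> ('a \<Rightarrow> nat) \<Rightarrow> nat" where
  "label_span G f = Max (f ` pverts G) - Min (f ` pverts G)"

definition radio_number :: "'a pair_pre_digraph \<Rightarrow> nat" where
  "radio_number G = (LEAST k. \<exists>f. radio_labeling G f \<and> label_span G f = k)"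

lemma pair_graph_stacked_book: "pair_graph (stacked_book m n)"
proof -
  let ?G = "stacked_book m n"
  have V: "pverts ?G = {0..<m} \<times> {0..<n}"
    by (simp add: stacked_book_def cartesian_product_def star_graph_def path_graph_def)
  have sub: "parcs ?G \<subseteq> pverts ?G \<times> pverts ?G"
    by (auto simp: stacked_book_def cartesian_product_def star_graph_def path_graph_def)
  have fin: "finite (parcs ?G)"
    by (rule finite_subset[OF sub]) (simp add: V)
  show ?thesis
  proof
    show "symmetric (with_proj ?G)"
      by (auto simp: symmetric_def sym_def stacked_book_def cartesian_product_def
            star_graph_def path_graph_def)
    show "fst e \<noteq> snd e" if "e \<in> parcs ?G" for e
      using that by (auto simp: stacked_book_def cartesian_product_def
            star_graph_def path_graph_def)
  qed (use sub fin V in auto)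
qed

end

theory Submission
  imports Defs
begin

text \<open>
  Write \<open>n = 2 k\<close>.  The vertices are visited alternately in the upper half \<open>{k..<2 k}\<close> and the lower
  half \<open>{0..<k}\<close> of the path: the \<open>i\<close>-th upper vertex is \<open>(i mod m, k + i div m)\<close>, the \<open>i\<close>-th lower
  vertex is \<open>((i + 2) mod m, i div m)\<close>, except that the last two lower vertices are exchanged.
  The visit thus starts and ends at centres of stars and never passes directly from centre to centre.
  Consecutive labels are chosen as close as the radio condition for consecutive vertices allows.
  All these gaps are at least \<open>k\<close>, so that only vertices at most three steps apart
  can violate the radio condition, and these turn out to be far enough from each other.
\<close>

section \<open>General tools for distances and radio numbers\<close>

text \<open>A potential certifies the distance: it drops by at most 1 per arc, so no walk to
  \<open>v\<close> is shorter than its value, and following \<open>descent\<close> gives a walk of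
  exactly that length.\<close>

lemma graph_dist_eqI:
  fixes \<delta> :: "'a \<Rightarrow> nat"
  assumes wf: "pair_wf_digraph G" and "u \<in> pverts G"
    and zero: "\<And>w. w \<in> pverts G \<Longrightarrow> \<delta> w = 0 \<longleftrightarrow> w = v"
    and lipschitz: "\<And>w w'. (w, w') \<in> parcs G \<Longrightarrow> \<delta> w \<le> Suc (\<delta> w')"
    and descent: "\<And>w. w \<in> pverts G \<Longrightarrow> w \<noteq> v \<Longrightarrow> \<exists>w'. (w, w') \<in> parcs G \<and> \<delta> w = Suc (\<delta> w')"
  shows "graph_dist G u v = \<delta> u"
proof -
  interpret pair_wf_digraph G by (rule wf)
  have ex: "\<exists>p. awalk w p v \<and> length p = \<delta> w" if "w \<in> pverts G" for w
    using that
  proof (induction "\<delta> w" arbitrary: w)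
    case 0
    then have "w = v" using zero by auto
    with 0 show ?case by (intro exI[of _ "[]"]) (simp add: awalk_Nil_iff)
  next
    case (Suc d)
    then have "w \<noteq> v" using zero[of w] by auto
    then obtain w' where w': "(w, w') \<in> parcs G" "\<delta> w = Suc (\<delta> w')"
      using descent Suc.prems by blast
    moreover have "w' \<in> pverts G" using w'(1) in_arcsD2 by blast
    ultimately obtain p where "awalk w' p v" "length p = \<delta> w'" using Suc by auto
    with w' show ?case
      by (intro exI[of _ "(w, w') # p"]) (simp add: awalk_Cons_iff)
  qed
  have lower: "\<delta> w \<le> length p" if "awalk w p v" for w p
    using that
  proof (induction p arbitrary: w)
    case Nil
    then show ?case using zero by (auto simp: awalk_Nil_iff)
  next
    case (Cons e p)
    then have "(w, snd e) \<in> parcs G" "awalk (snd e) p v"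
      by (auto simp: awalk_Cons_iff)
    then show ?case using Cons.IH lipschitz by fastforce
  qed
  show ?thesis
    unfolding graph_dist_def
    by (rule Least_equality) (use ex \<open>u \<in> pverts G\<close> lower in auto)
qed

text \<open>Each vertex receives the value of \<open>F\<close> at one chosen position of the
  enumeration. The radio condition is stated additively to avoid truncated subtraction.\<close>

lemma radio_number_le_if_enumeration:
  fixes x :: "nat \<Rightarrow> 'a" and F :: "nat \<Rightarrow> nat"
  assumes "finite (pverts G)" "pverts G \<noteq> {}"
    and onto: "pverts G \<subseteq> x ` {..<N}"
    and sym: "\<And>u v. u \<in> pverts G \<Longrightarrow> v \<in> pverts G \<Longrightarrow> graph_dist G u v = graph_dist G v u"
    and radio: "\<And>s t. s < t \<Longrightarrow> t < N \<Longrightarrow> x s \<in> pverts G \<Longrightarrow> x t \<in> pverts G \<Longrightarrow>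
      F s + graph_diam G + 1 \<le> F t + graph_dist G (x s) (x t)"
    and bound: "\<And>t. t < N \<Longrightarrow> F t \<le> B"
  shows "radio_number G \<le> B"
proof -
  define idx where "idx = inv_into {..<N} x"
  have idx: "idx v < N" "x (idx v) = v" if "v \<in> pverts G" for v
    using that onto inv_into_into[of v x "{..<N}"] f_inv_into_f[of v x "{..<N}"]
    by (auto simp: idx_def)
  have "radio_labeling G (F \<circ> idx)"
    unfolding radio_labeling_def
  proof (intro ballI impI)
    fix u v assume uv: "u \<in> pverts G" "v \<in> pverts G" "u \<noteq> v"
    then consider "idx u < idx v" | "idx v < idx u"
      by (metis idx(2) linorder_neqE_nat)
    then show "int (graph_diam G) + 1 - int (graph_dist G u v)
        \<le> \<bar>int ((F \<circ> idx) u) - int ((F \<circ> idx) v)\<bar>"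
      by cases (use radio[of "idx u" "idx v"] radio[of "idx v" "idx u"] idx uv sym[of u v] in auto)
  qed
  then have "radio_number G \<le> label_span G (F \<circ> idx)"
    unfolding radio_number_def by (intro Least_le) auto
  \<comment> \<open>Labels are naturals, so dropping the minimum only enlarges the value.\<close>
  also have "\<dots> \<le> Max ((F \<circ> idx) ` pverts G)" by (simp add: label_span_def)
  also have "\<dots> \<le> B" using assms(1,2) bound idx by (auto simp: Max_le_iff)
  finally show ?thesis .
qed

section \<open>Distances and diameter of the stacked book\<close>

definition star_dist :: "nat \<Rightarrow> nat \<Rightarrow> nat" where
  "star_dist c c' = (if c = c' then 0 else if c = 0 \<or> c' = 0 then 1 else 2)"

text \<open>One of the two truncated differences is 0, so their sum is the distance in the
  path.\<close>

definition book_dist :: "nat \<times> nat \<Rightarrow> nat \<times> nat \<Rightarrow> nat" where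
  "book_dist u v = star_dist (fst u) (fst v) + ((snd u - snd v) + (snd v - snd u))"

lemma book_dist_commute: "book_dist u v = book_dist v u"
  by (auto simp: book_dist_def star_dist_def)

lemma pverts_stacked_book: "pverts (stacked_book m n) = {0..<m} \<times> {0..<n}"
  by (simp add: stacked_book_def cartesian_product_def star_graph_def path_graph_def)

lemma parcs_stacked_book:
  "((c, p), (c', p')) \<in> parcs (stacked_book m n) \<longleftrightarrow>
     c < m \<and> c' < m \<and> p < n \<and> p' < n \<and>
     (c = c' \<and> (p' = Suc p \<or> p = Suc p') \<or> p = p' \<and> c \<noteq> c' \<and> (c = 0 \<or> c' = 0))"
  by (auto simp: stacked_book_def cartesian_product_def star_graph_def path_graph_def)

lemma graph_dist_stacked_book:
  assumes "u \<in> pverts (stacked_book m n)" "v \<in> pverts (stacked_book m n)"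
  shows "graph_dist (stacked_book m n) u v = book_dist u v"
proof (rule graph_dist_eqI)
  show "pair_wf_digraph (stacked_book m n)"
    using pair_graph_stacked_book[of m n]
    by (simp add: pair_graph_def pair_digraph_def pair_fin_digraph_def)
  show "book_dist w v = 0 \<longleftrightarrow> w = v" for w
    by (auto simp: book_dist_def star_dist_def prod_eq_iff)
  show "book_dist w v \<le> Suc (book_dist w' v)" if "(w, w') \<in> parcs (stacked_book m n)" for w w'
    using that by (cases w; cases w') (auto simp: parcs_stacked_book book_dist_def star_dist_def)
next
  fix w assume w: "w \<in> pverts (stacked_book m n)" "w \<noteq> v"
  obtain c p c' p' where [simp]: "w = (c, p)" "v = (c', p')" by (cases w; cases v)
  have bounds: "c < m" "p < n" "c' < m" "p' < n" using assms w by (auto simp: pverts_stacked_book)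
  \<comment> \<open>First move along the path to the level of \<open>v\<close>, then inside the
    star, through the centre 0.\<close>
  define w' where "w' = (if p < p' then (c, Suc p) else if p' < p then (c, p - 1)
    else if c = 0 then (c', p) else (0, p))"
  have "(w, w') \<in> parcs (stacked_book m n) \<and> book_dist w v = Suc (book_dist w' v)"
    using bounds \<open>w \<noteq> v\<close> by (auto simp: w'_def parcs_stacked_book book_dist_def star_dist_def)
  then show "\<exists>w'. (w, w') \<in> parcs (stacked_book m n) \<and> book_dist w v = Suc (book_dist w' v)"
    by blast
qed (use assms in auto)

text \<open>The star contributes at most 2 and the path at most \<open>n - 1\<close>. An upper bound
  suffices, since a larger diameter only strengthens the radio condition.\<close>

lemma graph_diam_stacked_book_le:
  assumes "m > 0" "n > 0"
  shows "graph_diam (stacked_book m n) \<le> n + 1"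
proof -
  let ?V = "pverts (stacked_book m n)"
  let ?D = "{graph_dist (stacked_book m n) u v | u v. u \<in> ?V \<and> v \<in> ?V}"
  have fin: "finite ?V" by (simp add: pverts_stacked_book)
  have "?D = (\<lambda>(u, v). graph_dist (stacked_book m n) u v) ` (?V \<times> ?V)" by auto
  then have "finite ?D" using fin by simp
  moreover have "(0, 0) \<in> ?V" using assms by (simp add: pverts_stacked_book)
  then have "?D \<noteq> {}" by blast
  moreover have "d \<le> n + 1" if "d \<in> ?D" for d
  proof -
    obtain u v where uv: "u \<in> ?V" "v \<in> ?V" "d = book_dist u v"
      using \<open>d \<in> ?D\<close> by (auto simp: graph_dist_stacked_book)
    then show ?thesis
      by (cases u; cases v) (auto simp: pverts_stacked_book book_dist_def star_dist_def)
  qed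
  ultimately show ?thesis by (auto simp: graph_diam_def)
qed

section \<open>The visiting order and its labels\<close>

definition upper :: "nat \<Rightarrow> nat \<Rightarrow> nat \<Rightarrow> nat \<times> nat" where
  "upper m k i = (i mod m, k + i div m)"

text \<open>The equation between truth values puts the centre at residue \<open>m - 2\<close>,
  except on level \<open>k - 1\<close>, where it comes at residue \<open>m - 1\<close>.\<close>

definition lower :: "nat \<Rightarrow> nat \<Rightarrow> nat \<Rightarrow> nat \<times> nat" where
  "lower m k i =
     (if i mod m + 2 < m then i mod m + 2
      else if (i mod m + 2 = m) = (Suc (i div m) < k) then 0 else 1, i div m)"

definition visit :: "nat \<Rightarrow> nat \<Rightarrow> nat \<Rightarrow> nat \<times> nat" where
  "visit m k t = (if even t then upper m k (t div 2) else lower m k (t div 2))"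

text \<open>
  The smallest gap between consecutive labels is \<open>k\<close>, plus \<open>1\<close> if one of the two vertices is a
  centre, minus \<open>1\<close> if \<open>i div m\<close> increases; \<open>upper_extra\<close> and \<open>lower_extra\<close> accumulate these corrections.
\<close>

definition upper_extra :: "nat \<Rightarrow> nat \<Rightarrow> nat \<Rightarrow> nat" where
  "upper_extra m k i = 3 * (i div m) +
     (if i mod m = 0 then 0 else if Suc (i mod m) = m \<and> Suc (i div m) < k then 3 else 1)"

definition lower_extra :: "nat \<Rightarrow> nat \<Rightarrow> nat \<Rightarrow> nat" where
  "lower_extra m k i = 3 * (i div m) + 1 +
     (if Suc (i div m) < k then i mod m + 3 - m else i mod m + 2 - m)"

definition extra :: "nat \<Rightarrow> nat \<Rightarrow> nat \<Rightarrow> nat" where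
  "extra m k t = (if even t then upper_extra m k (t div 2) else lower_extra m k (t div 2))"

definition visit_label :: "nat \<Rightarrow> nat \<Rightarrow> nat \<Rightarrow> nat" where
  "visit_label m k t = k * t + extra m k t"

section \<open>The radio condition along the visit\<close>

lemma Suc_div_mod_cases:
  fixes i m :: nat
  assumes "m > 0"
  obtains "Suc (i mod m) < m" "Suc i mod m = Suc (i mod m)" "Suc i div m = i div m"
  | "Suc (i mod m) = m" "Suc i mod m = 0" "Suc i div m = Suc (i div m)"
proof (cases "Suc (i mod m) = m")
  case True
  then show ?thesis by (intro that(2)) (auto simp: mod_Suc div_Suc)
next
  case False
  with mod_less_divisor[OF assms, of i] have "Suc (i mod m) < m" by linarith
  with False show ?thesis by (intro that(1)) (auto simp: mod_Suc div_Suc)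
qed

lemma even_odd_half_cases:
  fixes t :: nat
  obtains i where "t = 2 * i" | i where "t = Suc (2 * i)"
  by (metis evenE oddE Suc_eq_plus1)

text \<open>The correction -1 at a change of level is harmless: that step enters an upper centre,
  whose +1 cancels it.\<close>

lemma extra_Suc: "m \<ge> 4 \<Longrightarrow> extra m k t \<le> extra m k (Suc t)"
proof -
  assume m: "m \<ge> 4"
  have j: "i mod m < m" for i using m by simp
  show ?thesis
  proof (cases t rule: even_odd_half_cases)
    case (1 i)
    then show ?thesis using m j[of i]
      by (auto simp: extra_def upper_extra_def lower_extra_def)
  next
    case (2 i)
    have "m > 0" using m by simp
    then show ?thesis using 2 m
      by (cases rule: Suc_div_mod_cases[OF \<open>m > 0\<close>, of i]) (auto simp: extra_def upper_extra_def lower_extra_def)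
  qed
qed

lemma extra_mono: "m \<ge> 4 \<Longrightarrow> s \<le> t \<Longrightarrow> extra m k s \<le> extra m k t"
  using lift_Suc_mono_le[of "extra m k"] extra_Suc by blast

text \<open>This is the radio condition for neighbours in the visit, with \<open>k * t + k\<close>
  cancelled. The levels differ by at least \<open>k\<close>, and the shift by 2 in
  \<open>lower\<close> makes successive leaves distinct, hence at star distance 2. On level
  \<open>k - 1\<close>, \<open>m \<ge> 4\<close> separates leaf 1 from column
  \<open>m - 2\<close>.\<close>

lemma book_dist_visit_1:
  assumes "m \<ge> 4"
  shows "extra m k t + k + 2 \<le> extra m k (t + 1) + book_dist (visit m k t) (visit m k (t + 1))"
proof -
  have "m > 0" using assms by simp
  then have j: "i mod m < m" for i by simp
  show ?thesis
  proof (cases t rule: even_odd_half_cases)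
    case (1 i)
    then show ?thesis using assms j[of i]
      by (auto simp: extra_def upper_extra_def lower_extra_def visit_def upper_def lower_def
          book_dist_def star_dist_def)
  next
    case (2 i)
    with \<open>m > 0\<close> assms show ?thesis
      by (cases rule: Suc_div_mod_cases[OF \<open>m > 0\<close>, of i])
        (auto simp: extra_def upper_extra_def lower_extra_def visit_def upper_def lower_def
          book_dist_def star_dist_def)
  qed
qed

text \<open>Two steps already gain \<open>2 * k\<close>, so 2 is missing. Two leaves supply it by
  their star distance; if a centre is involved, the star distance 1 is completed by a change of
  level or by a growth of \<open>extra\<close>.\<close>

lemma book_dist_visit_2:
  assumes "m \<ge> 4"
  shows "extra m k t + 2 \<le> extra m k (t + 2) + book_dist (visit m k t) (visit m k (t + 2))"
proof -
  have "m > 0" using assms by simp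
  show ?thesis
  proof (cases t rule: even_odd_half_cases)
    case (1 i)
    with \<open>m > 0\<close> assms show ?thesis
      by (cases rule: Suc_div_mod_cases[OF \<open>m > 0\<close>, of i])
        (auto simp: extra_def upper_extra_def visit_def upper_def book_dist_def star_dist_def)
  next
    case (2 i)
    with \<open>m > 0\<close> assms show ?thesis
      by (cases rule: Suc_div_mod_cases[OF \<open>m > 0\<close>, of i])
        (auto simp: extra_def lower_extra_def visit_def lower_def book_dist_def star_dist_def)
  qed
qed

text \<open>Three steps gain \<open>3 * k\<close>, so distance 1 suffices when
  \<open>k \<ge> 1\<close>. The two vertices lie in opposite halves; the bound on \<open>t\<close>
  keeps the lower one below level \<open>k\<close>.\<close>

lemma book_dist_visit_3:
  assumes "k \<ge> 1" "t + 3 < 2 * (m * k)"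
  shows "book_dist (visit m k t) (visit m k (t + 3)) \<ge> 1"
proof (cases t rule: even_odd_half_cases)
  case (1 i)
  have "Suc i < k * m" using assms(2) 1 by (simp add: mult.commute)
  then have "Suc i div m < k" by (rule less_mult_imp_div_less)
  moreover have "(t + 3) div 2 = Suc i" "odd (t + 3)" using 1 by auto
  ultimately show ?thesis using 1
    by (simp add: visit_def upper_def lower_def book_dist_def)
next
  case (2 i)
  have "i div m \<le> (i + 2) div m" by (rule div_le_mono) simp
  moreover have "(t + 3) div 2 = i + 2" "even (t + 3)" using 2 by auto
  ultimately show ?thesis using 2 assms(1)
    by (simp add: visit_def upper_def lower_def book_dist_def)
qed

lemma visit_label_radio:
  assumes "m \<ge> 4" "k \<ge> 1" "s < t" "t < 2 * (m * k)"
  shows "visit_label m k s + (2 * k + 2) \<le> visit_label m k t + book_dist (visit m k s) (visit m k t)"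
proof -
  define d where "d = t - s"
  then have d: "t = s + d" "d \<ge> 1" using \<open>s < t\<close> by simp_all
  have mono: "extra m k s \<le> extra m k t" using assms by (simp add: extra_mono)
  consider "d = 1" | "d = 2" | "d = 3" | "d \<ge> 4" using d(2) by linarith
  then show ?thesis
  proof cases
    case 1
    with d book_dist_visit_1[OF assms(1), of k s] show ?thesis by (simp add: visit_label_def)
  next
    case 2
    with d book_dist_visit_2[OF assms(1), of k s] show ?thesis
      by (simp add: visit_label_def algebra_simps)
  next
    case 3
    with d book_dist_visit_3[of k s m] assms mono show ?thesis
      by (simp add: visit_label_def algebra_simps)
  next
    \<comment> \<open>Four steps gain \<open>4 * k\<close>, which is at least
      \<open>2 * k + 2\<close>, so no distance is required.\<close>
    case 4
    then have "k * 4 \<le> k * d" by (rule mult_le_mono2)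
    moreover have "k * t = k * s + k * d" by (simp add: d(1) distrib_left)
    ultimately show ?thesis using mono assms(2) unfolding visit_label_def by linarith
  qed
qed

section \<open>Coverage, the largest label and the final bound\<close>

lemma visit_onto:
  assumes "m \<ge> 4" "c < m" "p < 2 * k"
  shows "(c, p) \<in> visit m k ` {..<2 * (m * k)}"
proof -
  have bound: "m * a + j < m * k" if "a < k" "j < m" for a j
  proof -
    have "m * a + j < m * Suc a" using that by simp
    also have "\<dots> \<le> m * k" using that by (intro mult_le_mono2) simp
    finally show ?thesis .
  qed
  show ?thesis
  proof (cases "k \<le> p")
    case True
    let ?i = "m * (p - k) + c"
    have "visit m k (2 * ?i) = (c, p)" using True assms by (simp add: visit_def upper_def)
    moreover have "?i < m * k" using bound assms True by simp
    ultimately show ?thesis by (intro image_eqI[of _ _ "2 * ?i"]) auto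
  next
    case False
    \<comment> \<open>\<open>j\<close> inverts the column map of \<open>lower\<close> on level
      \<open>p\<close>, including the exchange on the last level.\<close>
    define j where "j = (if c \<ge> 2 then c - 2 else if (c = 0) = (Suc p < k) then m - 2 else m - 1)"
    let ?i = "m * p + j"
    have j: "j < m" using assms by (auto simp: j_def)
    then have "visit m k (Suc (2 * ?i)) = (c, p)" using assms
      by (auto simp: visit_def lower_def j_def)
    moreover have "?i < m * k" using bound j False by simp
    ultimately show ?thesis by (intro image_eqI[of _ _ "Suc (2 * ?i)"]) auto
  qed
qed

text \<open>Labels increase along the visit, so the last one decides. Its correction is
  \<open>3 * (k - 1) + 2\<close>: the \<open>2 * k\<close> centres affect \<open>4 * k - 2\<close>
  gaps, as the first and last vertices have one gap each, and the \<open>k - 1\<close> changes of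
  level are subtracted.\<close>

lemma visit_label_le:
  assumes "m \<ge> 4" "k \<ge> 1" "t < 2 * (m * k)"
  shows "visit_label m k t \<le> 2 * m * k\<^sup>2 + 2 * k - 1"
proof -
  let ?T = "2 * (m * k) - 1" and ?i = "m * (k - 1) + (m - 1)"
  have mk: "m * k = m * (k - 1) + m" using assms by (cases k) auto
  have T: "?T = Suc (2 * ?i)" unfolding mk using assms(1) by simp
  have "t \<le> ?T" using assms by simp
  then have "visit_label m k t \<le> visit_label m k ?T"
    unfolding visit_label_def by (intro add_mono mult_le_mono2 extra_mono assms)
  also have "extra m k ?T = lower_extra m k ?i" unfolding T by (simp add: extra_def)
  then have "visit_label m k ?T = k * ?T + lower_extra m k ?i" by (simp add: visit_label_def)
  also have "?i div m = k - 1" "?i mod m = m - 1"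
    using assms(1) by (simp_all del: add_diff_assoc diff_Suc_1)
  then have "lower_extra m k ?i = 3 * (k - 1) + 2"
    using assms by (simp add: lower_extra_def)
  also have "k * ?T + (3 * (k - 1) + 2) = 2 * m * k\<^sup>2 + 2 * k - 1"
  proof -
    have "k * ?T + k = k * (?T + 1)" by simp
    also have "?T + 1 = 2 * (m * k)" using assms by simp
    finally have "k * ?T + k = 2 * m * k\<^sup>2" by (simp add: power2_eq_square)
    with assms(2) show ?thesis by linarith
  qed
  finally show ?thesis .
qed

theorem theorem3p9:
  fixes m n :: nat
  assumes "m \<ge> 3" and "even m" and "n > 0" and "even n"
  shows "real (radio_number (stacked_book m n)) \<le> real m * (real n)\<^sup>2 / 2 + real n - 1"
proof -
  obtain k where n: "n = 2 * k" using \<open>even n\<close> by blast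
  then have k: "k \<ge> 1" using \<open>n > 0\<close> by simp
  have m: "m \<ge> 4" using \<open>m \<ge> 3\<close> \<open>even m\<close> by (cases "m = 3") auto
  let ?G = "stacked_book m n"
  have "radio_number ?G \<le> 2 * m * k\<^sup>2 + 2 * k - 1"
  proof (rule radio_number_le_if_enumeration)
    show "finite (pverts ?G)" "pverts ?G \<noteq> {}"
      using m \<open>n > 0\<close> by (auto simp: pverts_stacked_book)
    show "pverts ?G \<subseteq> visit m k ` {..<2 * (m * k)}"
      using visit_onto[OF m] n by (auto simp: pverts_stacked_book)
    show "graph_dist ?G u v = graph_dist ?G v u" if "u \<in> pverts ?G" "v \<in> pverts ?G" for u v
      using that by (simp add: graph_dist_stacked_book book_dist_commute)
    show "visit_label m k s + graph_diam ?G + 1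
        \<le> visit_label m k t + graph_dist ?G (visit m k s) (visit m k t)"
      if "s < t" "t < 2 * (m * k)" "visit m k s \<in> pverts ?G" "visit m k t \<in> pverts ?G" for s t
      using visit_label_radio[OF m k that(1,2)] graph_diam_stacked_book_le[of m n] that(3,4) m n k
      by (simp add: graph_dist_stacked_book)
    show "visit_label m k t \<le> 2 * m * k\<^sup>2 + 2 * k - 1" if "t < 2 * (m * k)" for t
      using visit_label_le[OF m k that] .
  qed
  \<comment> \<open>Moving the 1 to the left removes the truncated subtraction before the cast to
    reals.\<close>
  then have "radio_number ?G + 1 \<le> 2 * m * k\<^sup>2 + 2 * k" using k by simp
  then have "real (radio_number ?G + 1) \<le> real (2 * m * k\<^sup>2 + 2 * k)" by (rule of_nat_mono)
  then show ?thesis by (simp add: n power2_eq_square algebra_simps)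
qed

end
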